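(* Let $A\in\mathbb{R}^{n\times n}$ be symmetric positive definite with eigenvalues $\lambda_1<\lambda_2<\dots<\lambda_n$, and let $v_1$ be a unit eigenvector for $\lambda_1$. There is a positive number $\delta$ such that for every unit vector $u_k\in\mathbb{R}^n$, setting $e_k=u_k-v_1$ and $\theta_k=u_k^\top Au_k$, if $\|e_k\|<\delta$ then $$J_k=(I-u_ku_k^\top)(A-\theta_kI)(I-u_ku_k^\top)$$ is symmetric positive definite on the subspace orthogonal to $u_k$. Moreover, $$\frac{\lambda_2-\lambda_1}{2}<z^\top J_kz<\lambda_n$$ for every unit norm vector $z$ orthogonal to $u_k$.
   Context: Norms are Euclidean. The vector $u_k$ plays the role of the $k$-th (normalized) approximation to $v_1$. *)

theory Defs
  imports "HOL-Analysis.Analysis"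
begin

definition eigenvector :: "real^'n^'n \<Rightarrow> real^'n \<Rightarrow> real \<Rightarrow> bool" where
  "eigenvector A v l \<longleftrightarrow> v \<noteq> 0 \<and> A *v v = l *\<^sub>R v"

definition eigenvalues :: "real^'n^'n \<Rightarrow> real set" where
  "eigenvalues A = {l. \<exists>v. eigenvector A v l}"

(* Symmetry is a property of the matrix M itself; only definiteness is restricted to S. *)
definition sym_pos_def_on :: "(real^'n) set \<Rightarrow> real^'n^'n \<Rightarrow> bool" where
  "sym_pos_def_on S M \<longleftrightarrow> transpose M = M \<and> (\<forall>z\<in>S. z \<noteq> 0 \<longrightarrow> 0 < z \<bullet> (M *v z))"

(* The projector I - u u^T; the column times row product contracts over the one-element type 1. *)
definition proj_perp :: "real^'n \<Rightarrow> real^'n^'n" where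
  "proj_perp u = mat 1 - (columnvector u :: real^1^'n) ** (rowvector u :: real^'n^1)"

end

theory Submission
  imports Defs
begin

text \<open>
  The \<open>n\<close> distinct eigenvalues provide an orthonormal eigenbasis containing \<open>v\<^sub>1\<close>, so with
  \<open>c = x \<bullet> v\<^sub>1\<close> every unit vector \<open>x\<close> satisfies
  \<open>\<lambda>\<^sub>2 - (\<lambda>\<^sub>2 - \<lambda>\<^sub>1) c\<^sup>2 \<le> x \<bullet> A x \<le> \<lambda>\<^sub>n - (\<lambda>\<^sub>n - \<lambda>\<^sub>1) c\<^sup>2\<close>.
  For a unit vector \<open>z \<bottom> u\<close> the quadratic form of \<open>J\<close> at \<open>z\<close> is \<open>z \<bullet> A z - \<theta>\<close>. As
  \<open>\<bar>z \<bullet> v\<^sub>1\<bar> = \<bar>z \<bullet> e\<bar> \<le> \<parallel>e\<parallel>\<close> and \<open>1 - (u \<bullet> v\<^sub>1)\<^sup>2 \<le> \<parallel>e\<parallel>\<^sup>2\<close>, it is at least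
  \<open>\<lambda>\<^sub>2 - \<lambda>\<^sub>1 - 2 (\<lambda>\<^sub>n - \<lambda>\<^sub>1) \<parallel>e\<parallel>\<^sup>2\<close>, and it is at most \<open>\<lambda>\<^sub>n - \<theta> < \<lambda>\<^sub>n\<close>.
\<close>

lemma symmetric_matrix_inner:
  fixes A :: "real^'n^'n"
  assumes "transpose A = A"
  shows "x \<bullet> (A *v y) = (A *v x) \<bullet> y"
  by (metis assms dot_lmul_matrix transpose_matrix_vector)

lemma symmetric_eigenvectors_orthogonal:
  fixes A :: "real^'n^'n"
  assumes "transpose A = A" "eigenvector A x k" "eigenvector A y l" "k \<noteq> l"
  shows "x \<bullet> y = 0"
proof -
  have "l * (x \<bullet> y) = k * (x \<bullet> y)"
    using symmetric_matrix_inner[OF assms(1), of x y] assms(2,3)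
    by (simp add: eigenvector_def)
  then show ?thesis using assms(4) by simp
qed

lemma eigenvector_normalize:
  fixes A :: "real^'n^'n"
  assumes "eigenvector A x l"
  shows "\<exists>y. eigenvector A y l \<and> norm y = 1"
  using assms
  by (intro exI[of _ "x /\<^sub>R norm x"])
     (auto simp: eigenvector_def matrix_vector_mult_scaleR)

lemma proj_perp_mult:
  fixes u :: "real^'n"
  shows "proj_perp u *v x = x - (u \<bullet> x) *\<^sub>R u"
proof -
  have "(columnvector u :: real^1^'n) ** (rowvector u :: real^'n^1) *v x = (u \<bullet> x) *\<^sub>R u"
    by (simp add: vec_eq_iff matrix_vector_mult_def matrix_matrix_mult_def columnvector_def
        rowvector_def inner_vec_def sum_distrib_left sum_distrib_right mult_ac)
  then show ?thesis
    by (simp add: proj_perp_def matrix_vector_mult_diff_rdistrib)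
qed

lemma transpose_proj_perp:
  fixes u :: "real^'n"
  shows "transpose (proj_perp u) = proj_perp u"
  by (simp add: vec_eq_iff transpose_def proj_perp_def matrix_matrix_mult_def columnvector_def
      rowvector_def mat_def mult.commute)

lemma transpose_proj_conj:
  fixes A :: "real^'n^'n"
  assumes "transpose A = A"
  shows "transpose (proj_perp u ** (A - mat t) ** proj_perp u)
       = proj_perp u ** (A - mat t) ** proj_perp u"
proof -
  have "transpose (A - mat t) = A - mat t"
    using assms by (simp add: vec_eq_iff transpose_def mat_def)
  then show ?thesis
    by (simp add: matrix_transpose_mul transpose_proj_perp matrix_mul_assoc)
qed

lemma quadratic_form_proj_conj:
  fixes A :: "real^'n^'n"
  assumes "orthogonal z u"
  shows "z \<bullet> ((proj_perp u ** (A - mat t) ** proj_perp u) *v z) = z \<bullet> (A *v z) - t * (z \<bullet> z)"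
proof -
  have Pz: "proj_perp u *v z = z"
    using assms by (simp add: proj_perp_mult orthogonal_def inner_commute)
  have "mat t *v z = t *\<^sub>R z"
    by (simp add: vec_eq_iff matrix_vector_mult_def mat_def if_distrib[where f="\<lambda>x. x * _"] cong: if_cong)
  then have "(A - mat t) *v z = A *v z - t *\<^sub>R z"
    by (simp add: matrix_vector_mult_diff_rdistrib)
  then show ?thesis
    using symmetric_matrix_inner[OF transpose_proj_perp, of z u "(A - mat t) *v z"] Pz
    by (simp add: matrix_vector_mul_assoc[symmetric] inner_diff_right)
qed

lemma orthonormal_eigenbasis_expansion:
  fixes A :: "real^'n^'n" and v :: "'i \<Rightarrow> real^'n"
  assumes I: "finite I" "card I = CARD('n)"
    and eig: "\<And>i. i \<in> I \<Longrightarrow> eigenvector A (v i) (l i)"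
    and unit: "\<And>i. i \<in> I \<Longrightarrow> norm (v i) = 1"
    and orth: "\<And>i j. i \<in> I \<Longrightarrow> j \<in> I \<Longrightarrow> i \<noteq> j \<Longrightarrow> v i \<bullet> v j = 0"
  shows "x \<bullet> x = (\<Sum>i\<in>I. (x \<bullet> v i)\<^sup>2)" and "x \<bullet> (A *v x) = (\<Sum>i\<in>I. l i * (x \<bullet> v i)\<^sup>2)"
proof -
  have inj: "inj_on v I"
  proof (rule inj_onI, rule ccontr)
    fix i j assume "i \<in> I" "j \<in> I" "v i = v j" "i \<noteq> j"
    then have "v i \<bullet> v i = 0" using orth by metis
    then show False using unit[OF \<open>i \<in> I\<close>] by simp
  qed
  have po: "pairwise orthogonal (v ` I)"
    using orth by (force simp: pairwise_def orthogonal_def)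
  have "0 \<notin> v ` I" using unit by force
  then have "independent (v ` I)" using po pairwise_orthogonal_independent by blast
  moreover have "card (v ` I) = dim (UNIV :: (real^'n) set)"
    using I inj by (simp add: card_image)
  ultimately have sp: "span (v ` I) = UNIV"
    using card_eq_dim[of "v ` I" UNIV] I by auto
  have x: "x = (\<Sum>i\<in>I. (x \<bullet> v i) *\<^sub>R v i)"
  proof -
    have "(\<Sum>b\<in>v ` I. (x \<bullet> b) *\<^sub>R b) = x"
      using po unit I sp by (intro orthonormal_basis_expand) auto
    then show ?thesis by (simp add: sum.reindex[OF inj])
  qed
  have "x \<bullet> x = x \<bullet> (\<Sum>i\<in>I. (x \<bullet> v i) *\<^sub>R v i)" using x by simp
  then show "x \<bullet> x = (\<Sum>i\<in>I. (x \<bullet> v i)\<^sup>2)"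
    by (simp add: inner_sum_right power2_eq_square)
  have "A *v x = A *v (\<Sum>i\<in>I. (x \<bullet> v i) *\<^sub>R v i)" using x by simp
  also have "\<dots> = (\<Sum>i\<in>I. (x \<bullet> v i) *\<^sub>R (l i *\<^sub>R v i))"
    using eig by (simp add: linear_sum[OF matrix_vector_mul_linear] matrix_vector_mult_scaleR
        eigenvector_def)
  finally show "x \<bullet> (A *v x) = (\<Sum>i\<in>I. l i * (x \<bullet> v i)\<^sup>2)"
    by (simp add: inner_sum_right power2_eq_square mult_ac)
qed

lemma quadratic_form_bounds:
  fixes A :: "real^'n^'n" and lam :: "nat \<Rightarrow> real"
  assumes dim: "CARD('n) \<ge> 2"
    and sym: "transpose A = A"
    and spectrum: "eigenvalues A = lam ` {1..CARD('n)}"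
    and ordered: "strict_mono_on {1..CARD('n)} lam"
    and v1: "eigenvector A v1 (lam 1)" "norm v1 = 1"
  shows "lam 2 * (x \<bullet> x) - (lam 2 - lam 1) * (x \<bullet> v1)\<^sup>2 \<le> x \<bullet> (A *v x)" (is ?lower)
    and "x \<bullet> (A *v x) \<le> lam CARD('n) * (x \<bullet> x) - (lam CARD('n) - lam 1) * (x \<bullet> v1)\<^sup>2"
      (is ?upper)
proof -
  let ?n = "CARD('n)"
  have "\<exists>y. eigenvector A y (lam i) \<and> norm y = 1" if "i \<in> {1..?n}" for i
  proof -
    have "lam i \<in> eigenvalues A" using that spectrum by blast
    then show ?thesis using eigenvector_normalize by (auto simp: eigenvalues_def)
  qed
  then obtain w where w: "\<And>i. i \<in> {1..?n} \<Longrightarrow> eigenvector A (w i) (lam i) \<and> norm (w i) = 1"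
    by metis
  define v where "v = w(1 := v1)"
  have v: "eigenvector A (v i) (lam i)" "norm (v i) = 1" if "i \<in> {1..?n}" for i
    using w[OF that] v1 by (auto simp: v_def)
  have orth: "v i \<bullet> v j = 0" if "i \<in> {1..?n}" "j \<in> {1..?n}" "i \<noteq> j" for i j
    using symmetric_eigenvectors_orthogonal[OF sym v(1) v(1)] that
      strict_mono_on_imp_inj_on[OF ordered] by (metis inj_onD)
  have mono: "lam i \<le> lam j" if "i \<in> {1..?n}" "j \<in> {1..?n}" "i \<le> j" for i j
    using strict_mono_onD[OF ordered that(1,2)] that(3) by (cases "i = j") auto
  have expand: "x \<bullet> x = (\<Sum>i\<in>{1..?n}. (x \<bullet> v i)\<^sup>2)"
    "x \<bullet> (A *v x) = (\<Sum>i\<in>{1..?n}. lam i * (x \<bullet> v i)\<^sup>2)"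
    using orthonormal_eigenbasis_expansion[of "{1..?n}" A v lam x] v orth by auto
  have "{1..?n} = insert 1 {2..?n}" using dim by auto
  then have split: "x \<bullet> x = (x \<bullet> v1)\<^sup>2 + (\<Sum>i\<in>{2..?n}. (x \<bullet> v i)\<^sup>2)"
    "x \<bullet> (A *v x) = lam 1 * (x \<bullet> v1)\<^sup>2 + (\<Sum>i\<in>{2..?n}. lam i * (x \<bullet> v i)\<^sup>2)"
    using expand by (auto simp: v_def)
  have "lam 2 * (\<Sum>i\<in>{2..?n}. (x \<bullet> v i)\<^sup>2) \<le> (\<Sum>i\<in>{2..?n}. lam i * (x \<bullet> v i)\<^sup>2)"
    unfolding sum_distrib_left using mono by (intro sum_mono mult_right_mono) auto
  then show ?lower unfolding split by (simp add: algebra_simps)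
  have "(\<Sum>i\<in>{2..?n}. lam i * (x \<bullet> v i)\<^sup>2) \<le> lam ?n * (\<Sum>i\<in>{2..?n}. (x \<bullet> v i)\<^sup>2)"
    unfolding sum_distrib_left using mono by (intro sum_mono mult_right_mono) auto
  then show ?upper unfolding split by (simp add: algebra_simps)
qed

theorem lemma3p1:
  fixes A :: "real^'n^'n" and lam :: "nat \<Rightarrow> real" and v1 :: "real^'n"
  assumes dim: "CARD('n) \<ge> 2"
    and spd: "sym_pos_def_on UNIV A"
    and spectrum: "eigenvalues A = lam ` {1..CARD('n)}"
    and ordered: "strict_mono_on {1..CARD('n)} lam"
    and v1: "eigenvector A v1 (lam 1)" "norm v1 = 1"
  shows "\<exists>\<delta>>0. \<forall>u :: real^'n. norm u = 1 \<longrightarrow>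
    (let e = u - v1;
         \<theta> = u \<bullet> (A *v u);
         J = proj_perp u ** (A - mat \<theta>) ** proj_perp u
     in norm e < \<delta> \<longrightarrow>
          sym_pos_def_on {z. orthogonal z u} J \<and>
          (\<forall>z. norm z = 1 \<and> orthogonal z u \<longrightarrow>
             (lam 2 - lam 1) / 2 < z \<bullet> (J *v z) \<and> z \<bullet> (J *v z) < lam CARD('n)))"
proof -
  let ?n = "CARD('n)"
  have sym: "transpose A = A" and pos: "\<And>x. x \<noteq> 0 \<Longrightarrow> 0 < x \<bullet> (A *v x)"
    using spd by (auto simp: sym_pos_def_on_def)
  note bounds = quadratic_form_bounds[OF dim sym spectrum ordered v1]
  have l12: "lam 1 < lam 2"
    using strict_mono_onD[OF ordered, of 1 2] dim by auto
  have l2n: "lam 2 \<le> lam ?n"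
    using strict_mono_onD[OF ordered, of 2 ?n] dim by (cases "?n = 2") auto
  define \<delta> where "\<delta> = sqrt ((lam 2 - lam 1) / (4 * (lam ?n - lam 1)))"
  have "\<delta> > 0" using l12 l2n by (simp add: \<delta>_def)
  have main: "(lam 2 - lam 1) / 2 < z \<bullet> (A *v z) - u \<bullet> (A *v u)"
    "z \<bullet> (A *v z) - u \<bullet> (A *v u) < lam ?n"
    if u: "norm u = 1" and e: "norm (u - v1) < \<delta>" and z: "norm z = 1" "orthogonal z u" for u z
  proof -
    let ?e = "(norm (u - v1))\<^sup>2"
    have uu: "u \<bullet> u = 1" and zz: "z \<bullet> z = 1" and vv: "v1 \<bullet> v1 = 1"
      using u z v1 by (simp_all add: norm_eq_1)
    have "?e < \<delta>\<^sup>2" using e by (simp add: power_strict_mono)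
    also have "\<delta>\<^sup>2 = (lam 2 - lam 1) / (4 * (lam ?n - lam 1))"
      using l12 l2n by (simp add: \<delta>_def)
    finally have small: "2 * (lam ?n - lam 1) * ?e < (lam 2 - lam 1) / 2"
      using l12 l2n by (simp add: field_simps)
    have "z \<bullet> v1 = - (z \<bullet> (u - v1))"
      using z by (simp add: orthogonal_def inner_diff_right)
    then have "\<bar>z \<bullet> v1\<bar> \<le> norm (u - v1)"
      using Cauchy_Schwarz_ineq2[of z "u - v1"] z by simp
    then have cz: "(z \<bullet> v1)\<^sup>2 \<le> ?e"
      by (metis abs_ge_zero power2_abs power_mono)
    have "?e = 2 - 2 * (u \<bullet> v1)"
      using uu vv by (simp add: power2_norm_eq_inner inner_diff inner_commute)
    moreover have "0 \<le> (1 - u \<bullet> v1)\<^sup>2" by simp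
    ultimately have cu: "1 - (u \<bullet> v1)\<^sup>2 \<le> ?e"
      by (simp add: power2_eq_square algebra_simps)
    have "lam 2 - (lam 2 - lam 1) * ?e \<le> z \<bullet> (A *v z)"
      using bounds(1)[of z] mult_left_mono[OF cz, of "lam 2 - lam 1"] zz l12
      by (simp add: algebra_simps)
    moreover have "u \<bullet> (A *v u) \<le> lam 1 + (lam ?n - lam 1) * ?e"
      using bounds(2)[of u] mult_left_mono[OF cu, of "lam ?n - lam 1"] uu l12 l2n
      by (simp add: algebra_simps)
    moreover have "(lam 2 - lam 1) * ?e \<le> (lam ?n - lam 1) * ?e"
      using l2n by (simp add: mult_right_mono)
    ultimately show "(lam 2 - lam 1) / 2 < z \<bullet> (A *v z) - u \<bullet> (A *v u)"
      using small by (simp add: field_simps)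
    have "0 \<le> (lam ?n - lam 1) * (z \<bullet> v1)\<^sup>2" using l12 l2n by simp
    then have "z \<bullet> (A *v z) \<le> lam ?n" using bounds(2)[of z] zz by simp
    moreover have "0 < u \<bullet> (A *v u)" using pos[of u] u by (cases "u = 0") auto
    ultimately show "z \<bullet> (A *v z) - u \<bullet> (A *v u) < lam ?n" by simp
  qed
  have posdef: "0 < z \<bullet> (A *v z) - u \<bullet> (A *v u) * (z \<bullet> z)"
    if u: "norm u = 1" and e: "norm (u - v1) < \<delta>" and z: "z \<noteq> 0" "orthogonal z u" for u z
  proof -
    let ?y = "z /\<^sub>R norm z"
    have "0 < ?y \<bullet> (A *v ?y) - u \<bullet> (A *v u)"
      using main(1)[OF u e, of ?y] z l12 by (simp add: orthogonal_def)
    then have "0 < (norm z)\<^sup>2 * (?y \<bullet> (A *v ?y) - u \<bullet> (A *v u))"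
      using z by (intro mult_pos_pos) auto
    also have "\<dots> = z \<bullet> (A *v z) - u \<bullet> (A *v u) * (z \<bullet> z)"
      using z by (simp add: matrix_vector_mult_scaleR power2_eq_square dot_square_norm
          field_simps)
    finally show ?thesis .
  qed
  show ?thesis
    unfolding Let_def
  proof (intro exI[of _ \<delta>] conjI allI impI \<open>\<delta> > 0\<close>)
    fix u :: "real^'n"
    assume u: "norm u = 1" and e: "norm (u - v1) < \<delta>"
    let ?J = "proj_perp u ** (A - mat (u \<bullet> (A *v u))) ** proj_perp u"
    show "sym_pos_def_on {z. orthogonal z u} ?J"
      unfolding sym_pos_def_on_def
      using posdef[OF u e] by (simp add: transpose_proj_conj[OF sym] quadratic_form_proj_conj)
    fix z assume "norm z = 1 \<and> orthogonal z u"
    then show "(lam 2 - lam 1) / 2 < z \<bullet> (?J *v z)" "z \<bullet> (?J *v z) < lam ?n"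
      using main[OF u e, of z] by (simp_all add: quadratic_form_proj_conj norm_eq_1)
  qed
qed

end
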